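(* Let $X$ be a totally disconnected compact metric space and $h\colon X\to X$ a homeomorphism. Let $(F,D)$ be an $h$-diagram associated with $(X,h)$, that is, the diagram constructed from some $h$-refined sequence of partitions $\{\mathcal P_n\}_{n\ge 0}$ of $X$. Then: (1) $(X,h)$ is an essentially minimal dynamical system if and only if $(F,D)$ is an essentially minimal $h$-diagram. (2) For any integer $m\ge 1$, it holds that $h^m=\mathrm{id}_X$ if and only if $(F,D)$ has global periodicity $m$.
   Context: Partitions. A partition of $X$ is a finite collection of non-empty, pairwise disjoint clopen subsets of $X$ whose union is $X$. A partition $\mathcal P_2$ is finer than $\mathcal P_1$, written $\mathcal P_2\precsim\mathcal P_1$, if every element of $\mathcal P_2$ is contained in an element of $\mathcal P_1$. The wedge $\mathcal P\wedge\mathcal Q$ is the partition of all non-empty intersections $Z\cap Z'$ with $Z\in\mathcal P$, $Z'\in\mathcal Q$. For a partition $\mathcal P$, $h^{\pm1}(\mathcal P)=\{h^{\pm1}(Z)\mid Z\in\mathcal P\}$. A sequence of partitions $\{\mathcal P_n\}_{n\ge0}$ of $X$ is $h$-refined if: (a) $\mathcal P_{n+1}\precsim\mathcal P_n$ for all $n\ge0$; (b) $\bigcup_{n\ge0}\mathcal P_n$ is a basis for the topology of $X$; (c) $\max\{\operatorname{diam}(Z)\mid Z\in\mathcal P_n\}\to0$ as $n\to\infty$; and (d) $\mathcal P_{n+1}\precsim h(\mathcal P_n)\wedge h^{-1}(\mathcal P_n)$ for all $n\ge0$. The $h$-diagram. Given an $h$-refined sequence $\{\mathcal P_n\}_{n\ge0}$,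 the associated $h$-diagram $(F,D)$ is the following directed graph $F$ with edges colored blue or red (the coloring encodes the separation $D$). The vertex set is $F^0=\bigsqcup_{n\ge0}F^{0,n}$ with $F^{0,n}=\mathcal P_n$ (the same subset of $X$ occurring in different levels gives different vertices). The edge set $F^1$ consists of the following edges, for every $n\ge0$, $Z\in\mathcal P_n$ and $Z'\in\mathcal P_{n+1}$: one blue edge $e(Z',Z)$ with source $Z'$ and range $Z$ whenever $Z'\subseteq Z$; and one red edge $f(Z',Z)$ with source $Z'$ and range $Z$ whenever $Z'\subseteq h^{(-1)^n}(Z)$ (i.e. $Z'\subseteq h(Z)$ if $n$ is even, $Z'\subseteq h^{-1}(Z)$ if $n$ is odd). The separation is $D=\bigsqcup_{Z\in F^0}D_Z$, where $D_Z=\{B_Z,R_Z\}$ with $B_Z$ (resp. $R_Z$) the set of blue (resp. red) edges with range $Z$. Paths. A finite path is a sequence of edges $\mu=g_0g_1\cdots g_n$ with $s(g_i)=r(g_{i+1})$; its range is $r(\mu)=r(g_0)$ and its source is $s(\mu)=s(g_n)$. Vertices $v$ are paths of length zero with $r(v)=s(v)=v$. An infinite path is an infinite sequence $g_0g_1\cdots$ with $s(g_i)=r(g_{i+1})$ for all $i\geq 0$; it is blue if all its edges are blue. A vertex $w$ is connected to a vertex $v$, written $w\leadsto v$, if there is a finite path $\mu$ (edges of any colors) with $s(\mu)=w$ and $r(\mu)=v$. Essential minimality of diagrams. An infinite blue path $\gamma=e_0e_1\cdots$ satisfies property (EM) if for every $i\ge0$ there exists an integer $n_i\ge0$ such that every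 vertex $v\in F^{0,n_i}$ is connected to $r(e_i)$. $(F,D)$ is essentially minimal if there exists an infinite blue path satisfying property (EM). Global periodicity of diagrams. For $m\ge1$, $(F,D)$ has global periodicity $m$ if for each finite path $\mu$ whose edges alternate between red and blue (consecutive edges have different colors) and which contains exactly $m$ red edges, there exists a finite path $\mu'$ consisting entirely of blue edges such that $r(\mu)=r(\mu')$ and $s(\mu)=s(\mu')$. Essential minimality of systems. A minimal set for $(X,h)$ is a closed, non-empty subset $Z\subseteq X$ with $h(Z)=Z$ such that any closed, non-empty $Z'\subseteq Z$ with $h(Z')=Z'$ equals $Z$. $(X,h)$ is essentially minimal if there is a unique minimal set. *)

theory Defs
  imports "HOL-Analysis.Analysis" "HOL-Library.Disjoint_Sets"
begin

section \<open>Partitions of a space and refined sequences\<close>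

text \<open>The space is a subset \<open>X\<close> of a metric space with its subspace topology \<open>top_of_set X\<close>
  (so that \<open>X\<close> may be empty). A homeomorphism of \<open>X\<close> is a pair \<open>h\<close>, \<open>k\<close> of mutually inverse
  maps with \<open>homeomorphism X X h k\<close>; below, \<open>k\<close> always plays the role of the inverse of \<open>h\<close>.\<close>

definition totally_disconnected :: "'a::topological_space set \<Rightarrow> bool" where
  "totally_disconnected X \<longleftrightarrow> (\<forall>S\<subseteq>X. connected S \<longrightarrow> (\<exists>a. S \<subseteq> {a}))"

definition clopen_partition :: "'a::topological_space set \<Rightarrow> 'a set set \<Rightarrow> bool" where
  "clopen_partition X P \<longleftrightarrow>
     finite P \<and> partition_on X P \<and>
     (\<forall>Z\<in>P. openin (top_of_set X) Z \<and> closedin (top_of_set X) Z)"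

definition wedge :: "'a set set \<Rightarrow> 'a set set \<Rightarrow> 'a set set" where
  "wedge P Q = {Z \<inter> Z' |Z Z'. Z \<in> P \<and> Z' \<in> Q \<and> Z \<inter> Z' \<noteq> {}}"

definition topological_basis_on :: "'a::topological_space set \<Rightarrow> 'a set set \<Rightarrow> bool" where
  "topological_basis_on X B \<longleftrightarrow>
     (\<forall>Z\<in>B. openin (top_of_set X) Z) \<and>
     (\<forall>U. openin (top_of_set X) U \<longrightarrow> (\<exists>B'\<subseteq>B. \<Union>B' = U))"

text \<open>\<open>refines X P Q\<close> says that \<open>P\<close> is finer than \<open>Q\<close>. Inserting \<open>0\<close> below only
  matters for empty \<open>X\<close>: the maximum over the empty partition is then \<open>0\<close>.\<close>

definition h_refined ::
  "'a::metric_space set \<Rightarrow> ('a \<Rightarrow> 'a) \<Rightarrow> ('a \<Rightarrow> 'a) \<Rightarrow> (nat \<Rightarrow> 'a set set) \<Rightarrow> bool" where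
  "h_refined X h k P \<longleftrightarrow>
     (\<forall>n. clopen_partition X (P n)) \<and>
     (\<forall>n. refines X (P (Suc n)) (P n)) \<and>
     topological_basis_on X (\<Union>n. P n) \<and>
     (\<lambda>n. Max (insert 0 (diameter ` P n))) \<longlonglongrightarrow> 0 \<and>
     (\<forall>n. refines X (P (Suc n)) (wedge ((`) h ` P n) ((`) k ` P n)))"

section \<open>Two-coloured graded graphs\<close>

datatype colour = Blue | Red

text \<open>The colouring encodes the separation: the edges with range \<open>v\<close> are separated into the
  blue and the red ones.\<close>

record ('v, 'e) diagram =
  level :: "nat \<Rightarrow> 'v set"
  edges :: "'e set"
  src :: "'e \<Rightarrow> 'v"
  rng :: "'e \<Rightarrow> 'v"
  col :: "'e \<Rightarrow> colour"

definition vertices :: "('v, 'e) diagram \<Rightarrow> 'v set" where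
  "vertices F = (\<Union>n. level F n)"

text \<open>\<open>is_path F v \<mu> w\<close>: \<open>\<mu>\<close> is a finite path with range \<open>v\<close> and source \<open>w\<close>. Paths are read
  from range to source; the empty list represents the path of length zero at \<open>v\<close>.\<close>

primrec is_path :: "('v, 'e) diagram \<Rightarrow> 'v \<Rightarrow> 'e list \<Rightarrow> 'v \<Rightarrow> bool" where
  "is_path F v [] w \<longleftrightarrow> v \<in> vertices F \<and> v = w"
| "is_path F v (g # \<mu>) w \<longleftrightarrow> g \<in> edges F \<and> rng F g = v \<and> is_path F (src F g) \<mu> w"

definition is_infinite_path :: "('v, 'e) diagram \<Rightarrow> (nat \<Rightarrow> 'e) \<Rightarrow> bool" where
  "is_infinite_path F \<gamma> \<longleftrightarrow>
     (\<forall>i. \<gamma> i \<in> edges F \<and> src F (\<gamma> i) = rng F (\<gamma> (Suc i)))"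

definition connected_to :: "('v, 'e) diagram \<Rightarrow> 'v \<Rightarrow> 'v \<Rightarrow> bool" where
  "connected_to F w v \<longleftrightarrow> (\<exists>\<mu>. is_path F v \<mu> w)"

definition EM :: "('v, 'e) diagram \<Rightarrow> (nat \<Rightarrow> 'e) \<Rightarrow> bool" where
  "EM F \<gamma> \<longleftrightarrow> (\<forall>i. \<exists>n. \<forall>v\<in>level F n. connected_to F v (rng F (\<gamma> i)))"

definition essentially_minimal_diagram :: "('v, 'e) diagram \<Rightarrow> bool" where
  "essentially_minimal_diagram F \<longleftrightarrow>
     (\<exists>\<gamma>. is_infinite_path F \<gamma> \<and> (\<forall>i. col F (\<gamma> i) = Blue) \<and> EM F \<gamma>)"

definition global_periodicity :: "('v, 'e) diagram \<Rightarrow> nat \<Rightarrow> bool" where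
  "global_periodicity F m \<longleftrightarrow>
     (\<forall>v w \<mu>. is_path F v \<mu> w \<and> distinct_adj (map (col F) \<mu>) \<and>
        length (filter (\<lambda>e. col F e = Red) \<mu>) = m \<longrightarrow>
        (\<exists>\<mu>'. is_path F v \<mu>' w \<and> (\<forall>e\<in>set \<mu>'. col F e = Blue)))"

section \<open>The diagram of a refined sequence\<close>

text \<open>A vertex \<open>(n, Z)\<close> is the set \<open>Z\<close> at level \<open>n\<close>; an edge is a triple of its colour,
  source and range.\<close>

type_synonym 'a vertex = "nat \<times> 'a set"
type_synonym 'a edge = "colour \<times> 'a vertex \<times> 'a vertex"

definition h_diagram ::
  "('a \<Rightarrow> 'a) \<Rightarrow> ('a \<Rightarrow> 'a) \<Rightarrow> (nat \<Rightarrow> 'a set set) \<Rightarrow> ('a vertex, 'a edge) diagram" where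
  "h_diagram h k P =
     \<lparr>level = (\<lambda>n. {n} \<times> P n),
      edges =
        {(Blue, (Suc n, Z'), (n, Z)) |n Z Z'. Z \<in> P n \<and> Z' \<in> P (Suc n) \<and> Z' \<subseteq> Z} \<union>
        {(Red, (Suc n, Z'), (n, Z)) |n Z Z'. Z \<in> P n \<and> Z' \<in> P (Suc n) \<and>
           Z' \<subseteq> (if even n then h ` Z else k ` Z)},
      src = (\<lambda>(c, s, r). s),
      rng = (\<lambda>(c, s, r). r),
      col = (\<lambda>(c, s, r). c)\<rparr>"

section \<open>Essentially minimal systems\<close>

definition minimal_set :: "'a::topological_space set \<Rightarrow> ('a \<Rightarrow> 'a) \<Rightarrow> 'a set \<Rightarrow> bool" where
  "minimal_set X h Z \<longleftrightarrow>
     closedin (top_of_set X) Z \<and> Z \<noteq> {} \<and> h ` Z = Z \<and>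
     (\<forall>Z'\<subseteq>Z. closedin (top_of_set X) Z' \<and> Z' \<noteq> {} \<and> h ` Z' = Z' \<longrightarrow> Z' = Z)"

definition essentially_minimal_system :: "'a::topological_space set \<Rightarrow> ('a \<Rightarrow> 'a) \<Rightarrow> bool" where
  "essentially_minimal_system X h \<longleftrightarrow> (\<exists>!Z. minimal_set X h Z)"

end

(* A path of the diagram moves a point by h, by its inverse, or not at all at each level.  A point
   and its successive images determine the cells containing them, so every itinerary of points is
   realised by a path (step_edge), and conversely a path records where the cell at its source has
   to go.  For (1), the cells connected to a fixed cell Z exhaust an open invariant set, which is
   everything by compactness when Z meets the only minimal set; conversely, a blue path with
   property (EM) shrinks to a point that lies in every minimal set.  For (2), in an alternating
   path all red edges sit at levels of the same parity, so they all apply h or all apply its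
   inverse. *)
theory Submission
  imports Defs
begin

section \<open>Auxiliary facts on paths, colour words and iterates\<close>

lemma is_path_snoc:
  assumes "is_path F v \<mu> (rng F g)" "g \<in> edges F" "src F g \<in> vertices F"
  shows "is_path F v (\<mu> @ [g]) (src F g)"
  using assms by (induction \<mu> arbitrary: v) auto

lemma distinct_adj_concat_replicate:
  "a \<noteq> b \<Longrightarrow> distinct_adj (concat (replicate r [a, b]))"
proof (induction r)
  case (Suc r)
  then show ?case by (cases r) auto
qed simp

lemma funpow_mem: "f ` A \<subseteq> A \<Longrightarrow> x \<in> A \<Longrightarrow> (f ^^ n) x \<in> A"
  by (induction n) auto

lemma funpow_left_inverse:
  assumes "\<And>x. x \<in> A \<Longrightarrow> g (f x) = x" "f ` A \<subseteq> A" "x \<in> A"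
  shows "(g ^^ n) ((f ^^ n) x) = x"
proof (induction n)
  case (Suc n)
  have "g (f ((f ^^ n) x)) = (f ^^ n) x"
    using assms funpow_mem by metis
  with Suc show ?case by (simp add: funpow_swap1)
qed simp

section \<open>Minimal sets of a compact system\<close>

lemma minimal_set_subset: "minimal_set X h M \<Longrightarrow> M \<subseteq> X"
  unfolding minimal_set_def by (elim conjE) (rule closedin_imp_subset)

lemma minimal_set_nonempty: "minimal_set X h M \<Longrightarrow> M \<noteq> {}"
  by (simp add: minimal_set_def)

text \<open>A finite non-empty subfamily of a chain contains its own intersection, which gives the
  finite intersection property. It serves both the Zorn argument and the shrinking cells along a
  blue path.\<close>

lemma compact_chain_Inter_nonempty:
  fixes D :: "'a::t2_space set set"
  assumes "\<And>S. S \<in> D \<Longrightarrow> compact S" "{} \<notin> D" "D \<noteq> {}" "subset.chain UNIV D"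
  shows "\<Inter>D \<noteq> {}"
proof -
  obtain S where S: "S \<in> D" using assms(3) by blast
  have "S \<inter> \<Inter>D \<noteq> {}"
  proof (rule compact_imp_fip)
    fix D' assume D': "finite D'" "D' \<subseteq> D"
    have "subset.chain UNIV (insert S D')"
      using assms(4) D' S by (auto simp: subset_chain_def)
    then have "\<Inter>(insert S D') \<in> insert S D'" using D'(1) by (intro Inter_in_chain) auto
    then show "S \<inter> \<Inter>D' \<noteq> {}" using D'(2) S assms(2) by auto
  qed (use assms(1) S compact_imp_closed in auto)
  then show ?thesis by blast
qed

text \<open>Injectivity makes \<open>M \<inter> N\<close> invariant, and it is closed and contains
  \<open>y\<close>. Minimality on both sides then identifies it with \<open>M\<close> and with
  \<open>N\<close>.\<close>

lemma minimal_set_eq: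
  assumes "inj_on h X" "minimal_set X h M" "minimal_set X h N" "y \<in> M" "y \<in> N"
  shows "M = N"
proof -
  have cl: "closedin (top_of_set X) (M \<inter> N)" and ne: "M \<inter> N \<noteq> {}"
    using assms by (auto simp: minimal_set_def)
  have "M \<subseteq> X" "N \<subseteq> X"
    using assms minimal_set_subset by blast+
  then have "h ` (M \<inter> N) = h ` M \<inter> h ` N"
    using assms(1) by (meson inj_on_image_Int)
  then have inv: "h ` (M \<inter> N) = M \<inter> N"
    using assms by (simp add: minimal_set_def)
  from cl ne inv assms have "M \<inter> N = M" "M \<inter> N = N"
    unfolding minimal_set_def by (metis inf_le1, metis inf_le2)
  then show ?thesis by simp
qed

text \<open>Zorn's lemma on the closed invariant non-empty subsets of \<open>K\<close>: compactness
  keeps the intersection of a chain non-empty, and injectivity keeps it invariant.\<close>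

lemma exists_minimal_set_subset:
  fixes X :: "'a::t2_space set"
  assumes "compact X" and inj: "inj_on h X"
    and K: "closedin (top_of_set X) K" "K \<noteq> {}" "h ` K = K"
  shows "\<exists>M\<subseteq>K. minimal_set X h M"
proof -
  define good where "good = (\<lambda>M. closedin (top_of_set X) M \<and> M \<noteq> {} \<and> h ` M = M \<and> M \<subseteq> K)"
  have KX: "K \<subseteq> X" using K closedin_subset[of "top_of_set X"] by simp
  \<comment> \<open>Passing to complements in \<open>K\<close> turns the search for a minimal set
    into one for a maximal element, the form in which Zorn's lemma is applied.\<close>
  define A where "A = {U. U \<subseteq> K \<and> good (K - U)}"
  have "A \<noteq> {}" using K by (auto simp: A_def good_def intro!: exI[of _ "{}"])
  moreover have "\<Union>C \<in> A" if C: "C \<noteq> {}" "subset.chain A C" for C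
  proof -
    have sub: "C \<subseteq> A" and lin: "\<And>U V. U \<in> C \<Longrightarrow> V \<in> C \<Longrightarrow> U \<subseteq> V \<or> V \<subseteq> U"
      using C(2) by (auto simp: subset_chain_def)
    define D where "D = (\<lambda>U. K - U) ` C"
    have D: "good S" if "S \<in> D" for S using that sub by (auto simp: D_def A_def)
    have "D \<noteq> {}" using C(1) by (simp add: D_def)
    have eq: "K - \<Union>C = \<Inter>D" using C(1) by (auto simp: D_def)
    have "\<Inter>D \<noteq> {}"
    proof (rule compact_chain_Inter_nonempty)
      show "compact S" if "S \<in> D" for S
        using D[OF that] assms(1) closedin_compact_eq[of X S] by (simp add: good_def)
      show "{} \<notin> D" using D by (auto simp: good_def)
      show "subset.chain UNIV D"
        unfolding subset_chain_def D_def using lin by blast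
    qed fact
    moreover have "closedin (top_of_set X) (\<Inter>D)"
      using D \<open>D \<noteq> {}\<close> by (intro closedin_Inter) (auto simp: good_def)
    moreover have "\<Inter>D \<subseteq> K" using eq by blast
    moreover have "h ` \<Inter>D = \<Inter>D"
    proof -
      have "\<forall>S\<in>D. S \<subseteq> X" using D KX by (auto simp: good_def)
      then have "h ` \<Inter>D = (\<Inter>S\<in>D. h ` S)"
        using \<open>D \<noteq> {}\<close> inj image_INT[of h X D "\<lambda>S. S"] by auto
      also have "\<dots> = \<Inter>D" using D by (simp add: good_def)
      finally show ?thesis .
    qed
    ultimately have "good (K - \<Union>C)" by (simp add: good_def eq)
    then show ?thesis using sub by (auto simp: A_def)
  qed
  ultimately obtain U where U: "U \<in> A" "\<And>V. V \<in> A \<Longrightarrow> U \<subseteq> V \<Longrightarrow> V = U"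
    using subset_Zorn_nonempty[of A] by blast
  have "minimal_set X h (K - U)"
    unfolding minimal_set_def
  proof (intro conjI allI impI)
    fix Z assume Z: "Z \<subseteq> K - U" "closedin (top_of_set X) Z \<and> Z \<noteq> {} \<and> h ` Z = Z"
    then have "K - (K - Z) = Z" "U \<subseteq> K - Z" using U(1) by (auto simp: A_def)
    moreover from this Z have "K - Z \<in> A" by (auto simp: A_def good_def)
    ultimately show "Z = K - U" using U(2) by metis
  qed (use U(1) in \<open>auto simp: A_def good_def\<close>)
  then show ?thesis by blast
qed

section \<open>Cells of a refined sequence\<close>

locale refined_system =
  fixes X :: "'a::metric_space set" and h k :: "'a \<Rightarrow> 'a" and P :: "nat \<Rightarrow> 'a set set"
  assumes compact_X: "compact X" and homeo: "homeomorphism X X h k"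
    and refined: "h_refined X h k P"
begin

abbreviation F where "F \<equiv> h_diagram h k P"

text \<open>This is $h^{(-1)^n}$, the map attached to red edges whose range lies at level
  \<open>n\<close>.\<close>

abbreviation level_map :: "nat \<Rightarrow> 'a \<Rightarrow> 'a" where
  "level_map n \<equiv> (if even n then h else k)"

lemma
  shows h_image: "h ` X = X" and k_image: "k ` X = X"
    and kh: "x \<in> X \<Longrightarrow> k (h x) = x" and hk: "x \<in> X \<Longrightarrow> h (k x) = x"
  using homeo by (auto simp: homeomorphism_def)

lemma h_in: "x \<in> X \<Longrightarrow> h x \<in> X" and k_in: "x \<in> X \<Longrightarrow> k x \<in> X"
  using h_image k_image by auto

lemma inj_h: "inj_on h X"
  using kh by (rule inj_on_inverseI)

lemma partition_P: "partition_on X (P n)"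
  using refined by (simp add: h_refined_def clopen_partition_def)

lemma cell_subset: "Z \<in> P n \<Longrightarrow> Z \<subseteq> X"
  using partition_onD1[OF partition_P] by blast

lemma cell_eq: "Z \<in> P n \<Longrightarrow> W \<in> P n \<Longrightarrow> x \<in> Z \<Longrightarrow> x \<in> W \<Longrightarrow> Z = W"
  using partition_onD2[OF partition_P, of n] by (auto dest: disjointD)

lemma cell_nonempty: "Z \<in> P n \<Longrightarrow> Z \<noteq> {}"
  using partition_onD3[OF partition_P] by blast

lemma obtain_cell:
  assumes "x \<in> X" obtains Z where "Z \<in> P n" "x \<in> Z"
  using partition_onD1[OF partition_P, of n] assms that by blast

lemma obtain_coarser_cell:
  assumes "Z' \<in> P (Suc n)" obtains W where "W \<in> P n" "Z' \<subseteq> W"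
proof -
  have "refines X (P (Suc n)) (P n)" using refined unfolding h_refined_def by blast
  then show ?thesis using assms that unfolding refines_def by blast
qed

lemma obtain_wedge_cell:
  assumes "Z' \<in> P (Suc n)" obtains W V where "W \<in> P n" "V \<in> P n" "Z' \<subseteq> h ` W \<inter> k ` V"
proof -
  have "refines X (P (Suc n)) (wedge ((`) h ` P n) ((`) k ` P n))"
    using refined unfolding h_refined_def by blast
  then obtain T where "T \<in> wedge ((`) h ` P n) ((`) k ` P n)" "Z' \<subseteq> T"
    using assms unfolding refines_def by blast
  then show ?thesis using that unfolding wedge_def by blast
qed

lemma openin_cell: "Z \<in> P n \<Longrightarrow> openin (top_of_set X) Z"
  and closedin_cell: "Z \<in> P n \<Longrightarrow> closedin (top_of_set X) Z"
  using refined by (auto simp: h_refined_def clopen_partition_def)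

lemma cells_small:
  assumes "e > 0"
  shows "\<exists>N. \<forall>n\<ge>N. \<forall>Z\<in>P n. \<forall>x\<in>Z. \<forall>y\<in>Z. dist x y < e"
proof -
  have "(\<lambda>n. Max (insert 0 (diameter ` P n))) \<longlonglongrightarrow> 0"
    using refined by (simp add: h_refined_def)
  then have "\<forall>\<^sub>F n in sequentially. Max (insert 0 (diameter ` P n)) < e"
    using assms by (rule order_tendstoD(2))
  then obtain N where N: "\<And>n. n \<ge> N \<Longrightarrow> Max (insert 0 (diameter ` P n)) < e"
    by (auto simp: eventually_sequentially)
  have "dist x y < e" if "n \<ge> N" "Z \<in> P n" "x \<in> Z" "y \<in> Z" for n Z x y
  proof -
    have "finite (P n)" using refined by (simp add: h_refined_def clopen_partition_def)
    then have "diameter Z < e" using N[OF that(1)] that(2) by simp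
    \<comment> \<open>\<open>diameter\<close> is a supremum of reals and bounds distances only on a
      bounded set; compactness of \<open>X\<close> provides this.\<close>
    moreover have "bounded Z"
      using compact_imp_bounded[OF compact_X] cell_subset[OF that(2)] by (rule bounded_subset)
    ultimately show ?thesis using diameter_bounded_bound[of Z x y] that by simp
  qed
  then show ?thesis by blast
qed

section \<open>Edges and paths of the diagram\<close>

lemma Blue_edge_iff:
  "(Blue, (n', Z'), (n, Z)) \<in> edges F \<longleftrightarrow> n' = Suc n \<and> Z \<in> P n \<and> Z' \<in> P (Suc n) \<and> Z' \<subseteq> Z"
  by (auto simp: h_diagram_def)

lemma Red_edge_iff:
  "(Red, (n', Z'), (n, Z)) \<in> edges F \<longleftrightarrow>
     n' = Suc n \<and> Z \<in> P n \<and> Z' \<in> P (Suc n) \<and> Z' \<subseteq> level_map n ` Z"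
  by (auto simp: h_diagram_def)

lemmas edge_iffs = Blue_edge_iff Red_edge_iff

lemma diagram_simps [simp]:
  "src F (c, s, r) = s" "rng F (c, s, r) = r" "col F (c, s, r) = c" "level F n = {n} \<times> P n"
  by (simp_all add: h_diagram_def)

lemma vertices_iff [simp]: "(n, Z) \<in> vertices F \<longleftrightarrow> Z \<in> P n"
  by (auto simp: vertices_def)

text \<open>Refinement already places \<open>Z'\<close> inside some cell of level \<open>n\<close>,
  or inside the image of one. The point \<open>x\<close> lies in that cell, so disjointness forces
  the cell to be \<open>Z\<close>. Thus a single point suffices to detect an inclusion of
  cells.\<close>

lemma step_edge:
  assumes "Z \<in> P n" "Z' \<in> P (Suc n)" "x \<in> Z"
  shows "x \<in> Z' \<Longrightarrow> (Blue, (Suc n, Z'), (n, Z)) \<in> edges F"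
    and "level_map n x \<in> Z' \<Longrightarrow> (Red, (Suc n, Z'), (n, Z)) \<in> edges F"
proof -
  assume "x \<in> Z'"
  moreover obtain W where "W \<in> P n" "Z' \<subseteq> W"
    using obtain_coarser_cell[OF assms(2)] .
  ultimately show "(Blue, (Suc n, Z'), (n, Z)) \<in> edges F"
    using assms cell_eq[of Z n W x] by (auto simp: edge_iffs)
next
  assume x: "level_map n x \<in> Z'"
  obtain W V where W: "W \<in> P n" "V \<in> P n" "Z' \<subseteq> h ` W \<inter> k ` V"
    using obtain_wedge_cell[OF assms(2)] .
  have xX: "x \<in> X" using assms cell_subset by blast
  have "Z' \<subseteq> level_map n ` Z"
  \<comment> \<open>The wedge supplies both images of cells; the parity of \<open>n\<close> selects
    the one to use, and injectivity brings the witness back to \<open>x\<close>.\<close>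
  proof (cases "even n")
    case True
    then obtain w where "w \<in> W" "h x = h w" using x W by auto
    then have "x \<in> W" using kh xX W cell_subset by (metis subsetD)
    then show ?thesis using True W cell_eq[of Z n W x] assms by auto
  next
    case False
    then obtain w where "w \<in> V" "k x = k w" using x W by auto
    then have "x \<in> V" using hk xX W cell_subset by (metis subsetD)
    then show ?thesis using False W cell_eq[of Z n V x] assms by auto
  qed
  with assms show "(Red, (Suc n, Z'), (n, Z)) \<in> edges F" by (simp add: edge_iffs)
qed

lemma path_source_cell: "is_path F v \<mu> (n', Z') \<Longrightarrow> Z' \<in> P n'"
  by (induction \<mu> arbitrary: v) auto

lemma edge_cases:
  assumes "g \<in> edges F"
  obtains c n Z Z' where "g = (c, (Suc n, Z'), (n, Z))" "Z \<in> P n" "Z' \<in> P (Suc n)"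
    "Z' \<subseteq> (if c = Red then level_map n ` Z else Z)"
proof -
  obtain c n' Z' n Z where g: "g = (c, (n', Z'), (n, Z))" by (metis prod.exhaust)
  show ?thesis
    using assms that by (cases c) (auto simp: g edge_iffs)
qed

section \<open>Blue paths as inclusions of cells\<close>

lemma blue_path_imp_subset:
  "is_path F (n, Z) \<mu> (n', Z') \<Longrightarrow> \<forall>e\<in>set \<mu>. col F e = Blue \<Longrightarrow> Z' \<subseteq> Z"
proof (induction \<mu> arbitrary: n Z)
  case (Cons g \<mu>)
  then have "g \<in> edges F" by simp
  then show ?case
  proof (cases rule: edge_cases)
    case (1 c l W W')
    then show ?thesis using Cons.IH[of "Suc l" W'] Cons.prems by auto
  qed
qed simp

text \<open>A fixed point of \<open>Z'\<close> selects one cell at each intermediate level, and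
  these cells are nested between \<open>Z'\<close> and \<open>Z\<close>.\<close>

lemma blue_path_if_subset:
  assumes "Z \<in> P n" "Z' \<in> P (n + l)" "Z' \<subseteq> Z"
  shows "\<exists>\<mu>. is_path F (n, Z) \<mu> (n + l, Z') \<and> (\<forall>e\<in>set \<mu>. col F e = Blue)"
  using assms
proof (induction l arbitrary: n Z)
  case 0
  moreover obtain x where "x \<in> Z'" using cell_nonempty[OF 0(2)] by blast
  ultimately have "Z' = Z" using cell_eq[of Z' n Z x] by auto
  then show ?case using 0 by (intro exI[of _ "[]"]) auto
next
  case (Suc l)
  obtain x where x: "x \<in> Z'" using cell_nonempty[OF Suc.prems(2)] by blast
  then have "x \<in> X" using Suc.prems(2) cell_subset by blast
  then obtain W where W: "W \<in> P (Suc n)" "x \<in> W" by (rule obtain_cell)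
  have "Z' \<subseteq> W"
  proof -
    \<comment> \<open>Refinement relates consecutive levels only, so the induction descends from the
      level of \<open>Z'\<close>, where \<open>Z'\<close> itself is the required cell.\<close>
    have coarser: "\<exists>V\<in>P m. Z' \<subseteq> V" if "m \<le> n + Suc l" for m
      using that
    proof (induction rule: inc_induct)
      case base
      then show ?case using Suc.prems by auto
    next
      case (step i)
      then obtain V where "V \<in> P (Suc i)" "Z' \<subseteq> V" by blast
      moreover from this obtain U where "U \<in> P i" "V \<subseteq> U"
        by (elim obtain_coarser_cell)
      ultimately show ?case by blast
    qed
    obtain V where "V \<in> P (Suc n)" "Z' \<subseteq> V" using coarser[of "Suc n"] by auto
    then show ?thesis using cell_eq[of V "Suc n" W x] W x by auto
  qed
  then obtain \<mu> where "is_path F (Suc n, W) \<mu> (Suc n + l, Z')" "\<forall>e\<in>set \<mu>. col F e = Blue"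
    using Suc.IH[of W "Suc n"] W Suc.prems by auto
  moreover have "(Blue, (Suc n, W), (n, Z)) \<in> edges F"
    using step_edge(1)[of Z n W x] Suc.prems W x by auto
  ultimately show ?case
    by (intro exI[of _ "(Blue, (Suc n, W), (n, Z)) # \<mu>"]) auto
qed

section \<open>Alternating paths and global periodicity\<close>

lemma path_levels: "is_path F (n, Z) \<mu> (n', Z') \<Longrightarrow> n' = n + length \<mu>"
proof (induction \<mu> arbitrary: n Z)
  case (Cons g \<mu>)
  then have "g \<in> edges F" by simp
  then show ?case
    by (cases rule: edge_cases) (use Cons in fastforce)
qed simp

lemma path_start_cell: "is_path F (n, Z) \<mu> w \<Longrightarrow> Z \<in> P n"
  by (cases \<mu>) (auto elim: edge_cases)

text \<open>\<open>p\<close> says that the red edges have their ranges at even levels; they then all apply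
  \<open>h\<close>, and otherwise all apply \<open>k\<close>.\<close>

lemma alternating_path_imp_subset:
  assumes "is_path F (n, Z) \<mu> (n', Z')" "distinct_adj (map (col F) \<mu>)"
    and "\<mu> \<noteq> [] \<Longrightarrow> col F (hd \<mu>) = Red \<longleftrightarrow> even n = p"
  shows "Z' \<subseteq> ((if p then h else k) ^^ length (filter (\<lambda>e. col F e = Red) \<mu>)) ` Z"
  using assms
proof (induction \<mu> arbitrary: n Z)
  case (Cons g \<mu>)
  let ?f = "if p then h else k" and ?r = "length (filter (\<lambda>e. col F e = Red) \<mu>)"
  from Cons have "g \<in> edges F" by simp
  then show ?case
  proof (cases rule: edge_cases)
    case (1 c l W W')
    have [simp]: "l = n" "W = Z" using 1 Cons.prems(1) by auto
    \<comment> \<open>Colour and parity of the level both switch from one edge to the next, so the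
      same \<open>p\<close> serves the tail.\<close>
    have "col F (hd \<mu>) = Red \<longleftrightarrow> even (Suc n) = p" if "\<mu> \<noteq> []"
      using that Cons.prems(2,3) 1(1) by (cases \<mu>; cases c; cases "col F (hd \<mu>)") auto
    then have "Z' \<subseteq> (?f ^^ ?r) ` W'"
      using Cons.IH[of "Suc n" W'] Cons.prems(1,2) 1(1) by (auto simp: distinct_adj_Cons)
    \<comment> \<open>If the first edge is red, then \<open>even n = p\<close>, and
      \<open>level_map n\<close> is exactly \<open>?f\<close>.\<close>
    also have "\<dots> \<subseteq> (?f ^^ ?r) ` (if c = Red then ?f ` Z else Z)"
      using 1 Cons.prems(3) by (intro image_mono) (auto split: if_splits)
    also have "\<dots> = (?f ^^ length (filter (\<lambda>e. col F e = Red) (g # \<mu>))) ` Z"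
      using 1(1) by (auto simp: image_comp funpow_swap1 simp del: funpow.simps
          simp add: funpow_Suc_right)
    finally show ?thesis .
  qed
qed auto

text \<open>Along an alternating path with \<open>m\<close> red edges the maps compose to the
  \<open>m\<close>-th iterate of \<open>h\<close> or of \<open>k\<close>. Both are the identity on
  \<open>X\<close>, so the source cell lies in the range cell and a blue path joins them.\<close>

lemma periodic_imp_global_periodicity:
  assumes per: "\<And>x. x \<in> X \<Longrightarrow> (h ^^ m) x = x"
  shows "global_periodicity F m"
  unfolding global_periodicity_def
proof (intro allI impI)
  fix v w \<mu>
  assume *: "is_path F v \<mu> w \<and> distinct_adj (map (col F) \<mu>) \<and>
    length (filter (\<lambda>e. col F e = Red) \<mu>) = m"
  obtain n Z n' Z' where vw: "v = (n, Z)" "w = (n', Z')" by fastforce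
  have Z: "Z \<in> P n" "Z' \<in> P n'" "n' = n + length \<mu>"
    using * vw path_start_cell path_source_cell path_levels by blast+
  \<comment> \<open>Regrouping the equivalences shows that this choice meets the parity condition at
    the first edge; for an empty path that condition is vacuous.\<close>
  define p where "p \<longleftrightarrow> (col F (hd \<mu>) = Red \<longleftrightarrow> even n)"
  have "Z' \<subseteq> ((if p then h else k) ^^ m) ` Z"
    using alternating_path_imp_subset[of n Z \<mu> n' Z' p] * vw by (auto simp: p_def)
  moreover have "((if p then h else k) ^^ m) x = x" if "x \<in> Z" for x
  proof -
    have "x \<in> X" using that Z cell_subset by blast
    then have "(k ^^ m) x = x"
      using funpow_left_inverse[of X k h x m] kh h_image per by simp
    then show ?thesis using per \<open>x \<in> X\<close> by simp
  qed
  ultimately have "Z' \<subseteq> Z" by auto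
  then show "\<exists>\<mu>'. is_path F v \<mu>' w \<and> (\<forall>e\<in>set \<mu>'. col F e = Blue)"
    using blue_path_if_subset[of Z n Z' "length \<mu>"] Z vw by simp
qed

text \<open>Each red edge moves the point by \<open>h\<close> and the following blue edge lets it
  rest. Two levels pass per round, so every red edge has its range at an even level.\<close>

lemma exists_alternating_path:
  assumes "even n" "Z \<in> P n" "x \<in> Z"
  shows "\<exists>\<mu> Z'. is_path F (n, Z) \<mu> (n + 2 * r, Z') \<and> (h ^^ r) x \<in> Z' \<and>
    map (col F) \<mu> = concat (replicate r [Red, Blue])"
  using assms
proof (induction r arbitrary: n Z x)
  case 0
  then show ?case by (intro exI[of _ "[]"] exI[of _ Z]) auto
next
  case (Suc r)
  have "h x \<in> X" using Suc.prems cell_subset h_in by blast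
  then obtain Z1 Z2 where
    Z1: "Z1 \<in> P (Suc n)" "h x \<in> Z1" and Z2: "Z2 \<in> P (Suc (Suc n))" "h x \<in> Z2"
    by (metis obtain_cell)
  let ?g1 = "(Red, (Suc n, Z1), (n, Z))" and ?g2 = "(Blue, (Suc (Suc n), Z2), (Suc n, Z1))"
  have "?g1 \<in> edges F" using step_edge(2)[of Z n Z1 x] Suc.prems Z1 by auto
  moreover have "?g2 \<in> edges F" using step_edge(1)[OF Z1(1) Z2(1) Z1(2) Z2(2)] .
  moreover obtain \<mu> Z' where
    "is_path F (Suc (Suc n), Z2) \<mu> (Suc (Suc n) + 2 * r, Z')" "(h ^^ r) (h x) \<in> Z'"
    "map (col F) \<mu> = concat (replicate r [Red, Blue])"
    using Suc.IH[of "Suc (Suc n)" Z2 "h x"] Suc.prems(1) Z2 by auto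
  ultimately show ?case
    by (intro exI[of _ "?g1 # ?g2 # \<mu>"] exI[of _ Z']) (auto simp: funpow_swap1)
qed

text \<open>If \<open>x\<close> moved under the \<open>m\<close>-th iterate, a fine enough cell
  around \<open>x\<close> would miss its image. The blue path granted by global periodicity puts
  both points into that cell.\<close>

lemma global_periodicity_imp_periodic:
  assumes gp: "global_periodicity F m" and x: "x \<in> X"
  shows "(h ^^ m) x = x"
proof (rule ccontr)
  assume ne: "(h ^^ m) x \<noteq> x"
  then have "dist ((h ^^ m) x) x > 0" by simp
  then obtain N where
    N: "\<And>n Z y z. n \<ge> N \<Longrightarrow> Z \<in> P n \<Longrightarrow> y \<in> Z \<Longrightarrow> z \<in> Z \<Longrightarrow> dist y z < dist ((h ^^ m) x) x"
    using cells_small by metis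
  \<comment> \<open>Doubling makes the level even, so that the red edges apply \<open>h\<close>,
    while keeping it at least \<open>N\<close>.\<close>
  define n where "n = 2 * N"
  obtain Z where Z: "Z \<in> P n" "x \<in> Z" using x by (rule obtain_cell)
  have "even n" "N \<le> n" by (auto simp: n_def)
  then obtain \<mu> Z' where \<mu>: "is_path F (n, Z) \<mu> (n + 2 * m, Z')" "(h ^^ m) x \<in> Z'"
    and c: "map (col F) \<mu> = concat (replicate m [Red, Blue])"
    using exists_alternating_path Z by blast
  have "length (filter (\<lambda>e. col F e = Red) \<mu>) = length (filter ((=) Red) (map (col F) \<mu>))"
    by (simp add: filter_map comp_def eq_commute)
  also have "\<dots> = m" unfolding c by (induction m) auto
  finally obtain \<mu>' where "is_path F (n, Z) \<mu>' (n + 2 * m, Z')" "\<forall>e\<in>set \<mu>'. col F e = Blue"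
    using gp \<mu>(1) c unfolding global_periodicity_def
    by (metis distinct_adj_concat_replicate colour.distinct(1))
  then have "Z' \<subseteq> Z" by (rule blue_path_imp_subset)
  then show False using N[OF \<open>N \<le> n\<close> Z(1), of "(h ^^ m) x" x] Z(2) \<mu>(2) by auto
qed

section \<open>From property (EM) to a unique minimal set\<close>

text \<open>A point of \<open>M\<close> is pulled back edge by edge from source to range. Since
  \<open>h\<close> maps \<open>M\<close> onto itself, undoing either \<open>h\<close> or
  \<open>k\<close> stays inside \<open>M\<close>.\<close>

lemma path_invariant_set:
  assumes "M \<subseteq> X" "h ` M = M" "is_path F (n, Z) \<mu> (n', Z')" "M \<inter> Z' \<noteq> {}"
  shows "M \<inter> Z \<noteq> {}"
  using assms(3,4)
proof (induction \<mu> arbitrary: n Z)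
  case (Cons g \<mu>)
  then have "g \<in> edges F" by simp
  then show ?case
  proof (cases rule: edge_cases)
    case (1 c l W W')
    have [simp]: "l = n" "W = Z" using 1 Cons.prems(1) by auto
    have "M \<inter> W' \<noteq> {}" using Cons.IH[of "Suc l" W'] Cons.prems 1 by auto
    then obtain x where x: "x \<in> M" "x \<in> W'" by blast
    have ZX: "Z \<subseteq> X" using 1(2) cell_subset by simp
    show ?thesis
    proof (cases "c = Red")
      case True
      then obtain z where z: "z \<in> Z" "x = level_map n z" using 1(4) x by auto
      have "z \<in> M"
      proof (cases "even n")
        case True
        then have "x = h z" using z by simp
        moreover obtain w where "w \<in> M" "x = h w" using x assms(2) by blast
        ultimately have "z = w"
          using inj_h assms(1) ZX z by (auto dest: inj_onD)
        then show ?thesis using \<open>w \<in> M\<close> by simp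
      next
        case False
        then have "z = h x" using z hk ZX by auto
        then show ?thesis using x assms(2) by blast
      qed
      then show ?thesis using z by blast
    qed (use x 1 in auto)
  qed
qed simp

text \<open>The cells along the blue path share a point \<open>y\<close>. Property (EM) makes every
  minimal set meet all of these cells, hence contain \<open>y\<close>, and minimal sets with a
  common point coincide.\<close>

lemma essentially_minimal_system_if_diagram:
  assumes "essentially_minimal_diagram F"
  shows "essentially_minimal_system X h"
proof -
  from assms obtain \<gamma> where \<gamma>: "\<And>i. \<gamma> i \<in> edges F" "\<And>i. src F (\<gamma> i) = rng F (\<gamma> (Suc i))"
    "\<And>i. col F (\<gamma> i) = Blue" and EM: "EM F \<gamma>"
    unfolding essentially_minimal_diagram_def is_infinite_path_def by blast
  define l where "l i = fst (rng F (\<gamma> i))" for i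
  define Z where "Z i = snd (rng F (\<gamma> i))" for i
  have rng: "rng F (\<gamma> i) = (l i, Z i)" for i by (simp add: l_def Z_def)
  have step: "l (Suc i) = Suc (l i) \<and> Z i \<in> P (l i) \<and> Z (Suc i) \<subseteq> Z i" for i
    using \<gamma>(1)[of i]
  proof (cases rule: edge_cases)
    case (1 c n W W')
    then have "c = Blue" using \<gamma>(3)[of i] by simp
    moreover have "l (Suc i) = Suc n" "Z (Suc i) = W'"
      using 1(1) \<gamma>(2)[of i, symmetric] by (simp_all add: l_def Z_def)
    ultimately show ?thesis using 1 by (auto simp: l_def Z_def)
  qed
  \<comment> \<open>The path may start at any level; this bound is enough to make its cells
    arbitrarily small.\<close>
  have l_ge: "i \<le> l i" for i by (induction i) (use step in \<open>auto simp: Suc_le_eq less_Suc_eq_le\<close>)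
  have "\<Inter>(range Z) \<noteq> {}"
  proof (rule compact_chain_Inter_nonempty)
    show "compact S" if "S \<in> range Z" for S
      using that step closedin_cell compact_X closedin_compact_eq by blast
    show "{} \<notin> range Z" using step cell_nonempty by fastforce
    have "Z n \<subseteq> Z m" if "m \<le> n" for m n
      by (rule lift_Suc_antimono_le[of Z]) (use step that in blast)+
    then show "subset.chain UNIV (range Z)"
      unfolding subset_chain_def by (metis imageE le_cases subset_UNIV)
  qed simp
  then obtain y where y: "\<And>i. y \<in> Z i" by blast
  have "y \<in> X" using y step[of 0] cell_subset by blast
  have y_min: "y \<in> M" if "minimal_set X h M" for M
  proof -
    from that have M: "closedin (top_of_set X) M" "M \<noteq> {}" "h ` M = M"
      unfolding minimal_set_def by blast+
    have MX: "M \<subseteq> X" using that by (rule minimal_set_subset)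
    obtain x where x: "x \<in> M" using M by blast
    have meets: "M \<inter> Z i \<noteq> {}" for i
    proof -
      obtain n where n: "\<And>v. v \<in> level F n \<Longrightarrow> connected_to F v (rng F (\<gamma> i))"
        using EM unfolding EM_def by blast
      obtain Z' where Z': "Z' \<in> P n" "x \<in> Z'" using obtain_cell x MX by blast
      then obtain \<mu> where "is_path F (l i, Z i) \<mu> (n, Z')"
        using n[of "(n, Z')"] by (auto simp: connected_to_def rng)
      then show ?thesis using path_invariant_set[OF MX M(3)] x Z' by blast
    qed
    have "y \<in> closure M"
      unfolding closure_approachable
    proof (intro allI impI)
      fix e :: real assume "e > 0"
      then obtain N where N: "\<forall>n\<ge>N. \<forall>Z\<in>P n. \<forall>x\<in>Z. \<forall>y\<in>Z. dist x y < e"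
        using cells_small by blast
      obtain z where "z \<in> M" "z \<in> Z N" using meets by blast
      then show "\<exists>z\<in>M. dist z y < e" using N l_ge[of N] step[of N] y by blast
    qed
    moreover have "closed M"
      using M(1) compact_X closedin_compact_eq compact_imp_closed by blast
    ultimately show ?thesis by simp
  qed
  \<comment> \<open>Existence comes from Zorn's lemma applied to \<open>X\<close> itself, which
    contains \<open>y\<close> and so is not empty.\<close>
  obtain M where "minimal_set X h M"
    using exists_minimal_set_subset[OF compact_X inj_h, of X] h_image \<open>y \<in> X\<close> by auto
  then show ?thesis
    unfolding essentially_minimal_system_def
    using y_min minimal_set_eq[OF inj_h] by blast
qed

section \<open>From a unique minimal set to property (EM)\<close>

lemma connected_to_step:
  assumes "connected_to F (n, Z) v" "Z \<in> P n" "Z' \<in> P (Suc n)" "x \<in> Z"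
    and "x \<in> Z' \<or> level_map n x \<in> Z'"
  shows "connected_to F (Suc n, Z') v"
proof -
  obtain c where g: "(c, (Suc n, Z'), (n, Z)) \<in> edges F"
    using assms(5) step_edge[OF assms(2,3,4)] by blast
  obtain \<mu> where "is_path F v \<mu> (n, Z)" using assms(1) by (auto simp: connected_to_def)
  then have "is_path F v (\<mu> @ [(c, (Suc n, Z'), (n, Z))]) (Suc n, Z')"
    using is_path_snoc[of F v \<mu> "(c, (Suc n, Z'), (n, Z))"] g assms(3) by simp
  then show ?thesis unfolding connected_to_def by blast
qed

text \<open>This turns connectedness of vertices into open subsets of \<open>X\<close> that increase
  with \<open>n\<close>, so that compactness can be applied.\<close>

definition reach :: "'a vertex \<Rightarrow> nat \<Rightarrow> 'a set" where
  "reach v n = \<Union>{Z \<in> P n. connected_to F (n, Z) v}"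

lemma reach_step:
  assumes "x \<in> reach v n"
  shows "x \<in> reach v (Suc n)" "level_map n x \<in> reach v (Suc n)"
proof -
  obtain Z where Z: "Z \<in> P n" "connected_to F (n, Z) v" "x \<in> Z"
    using assms by (auto simp: reach_def)
  have *: "y \<in> reach v (Suc n)" if "y \<in> X" "y = x \<or> y = level_map n x" for y
  proof -
    obtain Z' where "Z' \<in> P (Suc n)" "y \<in> Z'" using \<open>y \<in> X\<close> by (rule obtain_cell)
    then show ?thesis
      using connected_to_step[of n Z v Z' x] Z that by (auto simp: reach_def)
  qed
  have "x \<in> X" using Z cell_subset by blast
  then show "x \<in> reach v (Suc n)" "level_map n x \<in> reach v (Suc n)"
    using * h_in k_in by auto
qed

lemma reach_mono: "m \<le> n \<Longrightarrow> reach v m \<subseteq> reach v n"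
  by (rule lift_Suc_mono_le[of "reach v"]) (rule subsetI, rule reach_step(1))

text \<open>Red edges at consecutive levels apply \<open>h\<close> and \<open>k\<close> in turn. If
  the current level offers the wrong map, the point waits for one level along a blue edge.\<close>

lemma UN_reach_invariant:
  assumes "x \<in> (\<Union>n. reach v n)"
  shows "h x \<in> (\<Union>n. reach v n)" "k x \<in> (\<Union>n. reach v n)"
proof -
  obtain n where n: "x \<in> reach v n" using assms by blast
  note 1 = reach_step(1)[OF n]
  have "h x \<in> reach v (Suc n) \<or> h x \<in> reach v (Suc (Suc n))"
    "k x \<in> reach v (Suc n) \<or> k x \<in> reach v (Suc (Suc n))"
    using reach_step(2)[OF n] reach_step(2)[OF 1] by (auto split: if_splits)
  then show "h x \<in> (\<Union>n. reach v n)" "k x \<in> (\<Union>n. reach v n)" by blast+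
qed

lemma openin_reach: "openin (top_of_set X) (reach v n)"
  unfolding reach_def using openin_cell by blast

text \<open>The blue path follows the cells of a point \<open>y\<close> of the minimal set
  \<open>Y\<close>. The points that eventually reach a given cell of the path form an open invariant
  set \<open>?U\<close> containing \<open>y\<close>. A non-empty complement would contain a minimal
  set, necessarily \<open>Y\<close>, which is impossible. Compactness then yields a single level
  that works.\<close>

lemma essentially_minimal_diagram_if_system:
  assumes "essentially_minimal_system X h"
  shows "essentially_minimal_diagram F"
proof -
  from assms obtain Y where Y: "minimal_set X h Y" and uniq: "\<And>M. minimal_set X h M \<Longrightarrow> M = Y"
    unfolding essentially_minimal_system_def by blast
  obtain y where y: "y \<in> Y" "y \<in> X"
    using minimal_set_nonempty[OF Y] minimal_set_subset[OF Y] by blast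
  have "\<forall>n. \<exists>Z. Z \<in> P n \<and> y \<in> Z" using obtain_cell[OF y(2)] by metis
  then obtain Z where Z: "\<And>n. Z n \<in> P n" "\<And>n. y \<in> Z n" by metis
  define \<gamma> where "\<gamma> i = (Blue, (Suc i, Z (Suc i)), (i, Z i))" for i
  have "is_infinite_path F \<gamma>"
    using step_edge(1)[OF Z(1) Z(1) Z(2) Z(2)] by (simp add: is_infinite_path_def \<gamma>_def)
  moreover have "EM F \<gamma>"
    unfolding EM_def
  proof
    fix i
    let ?v = "(i, Z i)"
    let ?U = "\<Union>n. reach ?v n"
    have "connected_to F ?v ?v"
      using Z by (auto simp: connected_to_def intro!: exI[of _ "[]"])
    then have yU: "y \<in> ?U" using Z by (auto simp: reach_def)
    have opU: "openin (top_of_set X) ?U" using openin_reach by blast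
    then have UX: "?U \<subseteq> X" by (rule openin_imp_subset)
    have XU: "X - ?U = {}"
    proof (rule ccontr)
      assume ne: "X - ?U \<noteq> {}"
      have "h ` (X - ?U) = X - ?U"
      proof (intro equalityI subsetI)
        fix x assume "x \<in> h ` (X - ?U)"
        then obtain z where "z \<in> X" "z \<notin> ?U" "x = h z" by blast
        moreover from this have "x \<notin> ?U" using UN_reach_invariant(2)[of x ?v] kh[of z] by metis
        ultimately show "x \<in> X - ?U" using h_in by blast
      next
        fix x assume x: "x \<in> X - ?U"
        then have "k x \<notin> ?U" using UN_reach_invariant(1)[of "k x" ?v] hk[of x] by (metis DiffE)
        then have "k x \<in> X - ?U" using k_in x by blast
        then show "x \<in> h ` (X - ?U)" using hk[of x] x by (metis DiffD1 image_eqI)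
      qed
      moreover have "closedin (top_of_set X) (X - ?U)"
        using opU by (intro closedin_diff) auto
      ultimately obtain M where "M \<subseteq> X - ?U" "minimal_set X h M"
        using exists_minimal_set_subset[OF compact_X inj_h _ ne] by metis
      then have "Y \<subseteq> X - ?U" using uniq by blast
      then show False using y yU by blast
    qed
    obtain n where n: "X \<subseteq> reach ?v n"
    proof -
      have "\<forall>c\<in>range (reach ?v). openin (top_of_set X) c" "X \<subseteq> \<Union>(range (reach ?v))"
        using openin_reach XU by blast+
      then have "\<exists>D\<subseteq>range (reach ?v). finite D \<and> X \<subseteq> \<Union>D"
        using compact_X unfolding compact_eq_openin_cover by blast
      then obtain I where I: "finite I" "X \<subseteq> (\<Union>n\<in>I. reach ?v n)"
        by (metis finite_subset_image)
      \<comment> \<open>By monotonicity the largest index absorbs the finite subcover; inserting 0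
        covers an empty \<open>I\<close>, where \<open>Max I\<close> would be unspecified.\<close>
      have "(\<Union>n\<in>I. reach ?v n) \<subseteq> reach ?v (Max (insert 0 I))"
        using I(1) by (intro UN_least reach_mono) simp
      then show ?thesis using that I(2) by blast
    qed
    have "connected_to F w ?v" if "w \<in> level F n" for w
    proof -
      obtain W where W: "w = (n, W)" "W \<in> P n" using \<open>w \<in> level F n\<close> by auto
      obtain x where x: "x \<in> W" using cell_nonempty[OF W(2)] by blast
      then have "x \<in> reach ?v n" using n cell_subset W by blast
      then obtain V where "V \<in> P n" "connected_to F (n, V) ?v" "x \<in> V"
        by (auto simp: reach_def)
      \<comment> \<open>Cells of one level are disjoint, so \<open>W\<close>, sharing
        \<open>x\<close> with the connected cell \<open>V\<close>, is that cell.\<close>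
      then show ?thesis using cell_eq[of V n W x] W x by blast
    qed
    then show "\<exists>n. \<forall>v\<in>level F n. connected_to F v (rng F (\<gamma> i))"
      by (auto simp: \<gamma>_def)
  qed
  ultimately show ?thesis
    unfolding essentially_minimal_diagram_def by (intro exI[of _ \<gamma>]) (auto simp: \<gamma>_def)
qed

end

theorem mainTheorem1:
  fixes X :: "'a::metric_space set" and h k :: "'a \<Rightarrow> 'a" and P :: "nat \<Rightarrow> 'a set set"
  assumes "compact X" and "totally_disconnected X"
    and "homeomorphism X X h k"
    and "h_refined X h k P"
  shows "(essentially_minimal_system X h \<longleftrightarrow> essentially_minimal_diagram (h_diagram h k P)) \<and>
    (\<forall>m\<ge>1. (\<forall>x\<in>X. (h ^^ m) x = x) \<longleftrightarrow> global_periodicity (h_diagram h k P) m)"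
proof -
  interpret refined_system X h k P
    using assms by unfold_locales
  show ?thesis
    using essentially_minimal_system_if_diagram essentially_minimal_diagram_if_system
      periodic_imp_global_periodicity global_periodicity_imp_periodic by blast
qed

end
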